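(* Let $\mathcal X,\mathcal Y$ be finite alphabets, let $(X,Y)\sim P_{X,Y}$ on $\mathcal X\times\mathcal Y$, and let $Z=f(X,Y)$ for an arbitrary function $f$; let $P_Z$ be the distribution of $Z$. There exists a (finite-alphabet) random variable $T$, jointly distributed with $(X,Y,Z)$, such that $$I(Z;T|X,Y)=I(Z;T)=I(X;Y|T)=0$$ if and only if $P_{X,Y}$ lies in the convex hull of the set $$\mathcal A(P_Z)=\{Q_{X,Y}:\ I_Q(X;Y)=0,\ Q_Z=P_Z\}.$$
   Context: All random variables have finite alphabets. $I$ denotes Shannon (conditional) mutual information. In the definition of $\mathcal A(P_Z)$, $Q_{X,Y}$ ranges over probability distributions on $\mathcal X\times\mathcal Y$, $I_Q(X;Y)$ is the mutual information computed under $Q_{X,Y}$, and $Q_Z$ is the distribution of $f(X,Y)$ when $(X,Y)\sim Q_{X,Y}$. *)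

theory Defs
  imports "HOL-Probability.Probability"
begin

text \<open>
  Random variables are functions on a discrete probability space given by a pmf. All codomains
  used below are countable, so every set is measurable and products of counting spaces are
  again discrete. Logarithms are taken to base 2.
\<close>

definition mutual_info :: "'w pmf \<Rightarrow> ('w \<Rightarrow> 'a) \<Rightarrow> ('w \<Rightarrow> 'b) \<Rightarrow> real" where
  "mutual_info R U V =
     prob_space.mutual_information (measure_pmf R) 2 (count_space UNIV) (count_space UNIV) U V"

text \<open>\<open>cond_mutual_info R U V W\<close> is $I(U;V|W)$. The library defines it by the chain rule
  $I(U;V|W) = I(U;(V,W)) - I(U;W)$.\<close>

definition cond_mutual_info ::
    "'w pmf \<Rightarrow> ('w \<Rightarrow> 'a) \<Rightarrow> ('w \<Rightarrow> 'b) \<Rightarrow> ('w \<Rightarrow> 'c) \<Rightarrow> real" where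
  "cond_mutual_info R U V W =
     prob_space.conditional_mutual_information (measure_pmf R) 2
       (count_space UNIV) (count_space UNIV) (count_space UNIV) U V W"

definition product_laws :: "('x::finite \<times> 'y::finite \<Rightarrow> 'z) \<Rightarrow> 'z pmf \<Rightarrow> ('x \<times> 'y) pmf set" where
  "product_laws f PZ = {Q. mutual_info Q fst snd = 0 \<and> map_pmf f Q = PZ}"

text \<open>The probability vector of a pmf; convex hulls need the ambient real vector space.\<close>

definition pmf_vec :: "'a::finite pmf \<Rightarrow> real ^ 'a" where
  "pmf_vec Q = (\<chi> a. pmf Q a)"

end

theory Submission
  imports Defs
begin

text \<open>
  If \<open>T\<close> is as required, then the conditional laws of \<open>(X, Y)\<close> given \<open>T = t\<close> are product laws
  whose image under \<open>f\<close> is the law of \<open>Z\<close>, and \<open>P\<close> is their mixture. Conversely, let \<open>T\<close> be the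
  index of the component in a convex combination; then \<open>I(Z;T|X,Y) = 0\<close> holds automatically,
  because \<open>Z\<close> is a function of \<open>(X, Y)\<close>. Vanishing of mutual information is translated into
  factorisation of the point masses by the equality case of Gibbs' inequality.
\<close>

section \<open>Point masses of marginal and conditional laws\<close>

lemma pmf_map_marginal:
  assumes "finite B" "V ` set_pmf R \<subseteq> B"
  shows "pmf (map_pmf U R) u = (\<Sum>v\<in>B. pmf (map_pmf (\<lambda>x. (U x, V x)) R) (u, v))"
proof -
  \<comment> \<open>The two events agree only almost surely: off the support of \<open>R\<close>,
    \<open>V\<close> may take values outside \<open>B\<close>.\<close>
  have "pmf (map_pmf U R) u = measure R (\<Union>v\<in>B. (\<lambda>x. (U x, V x)) -` {(u, v)})"
    unfolding pmf_map using assms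
    by (intro measure_pmf.finite_measure_eq_AE) (auto simp: AE_measure_pmf_iff)
  also have "\<dots> = (\<Sum>v\<in>B. measure R ((\<lambda>x. (U x, V x)) -` {(u, v)}))"
    using assms by (intro measure_pmf.finite_measure_finite_Union) (auto simp: disjoint_family_on_def)
  finally show ?thesis by (simp add: pmf_map)
qed

lemma pmf_map_cond_pmf:
  assumes "t \<in> T ` set_pmf R"
  shows "pmf (map_pmf U (cond_pmf R (T -` {t}))) u =
    pmf (map_pmf (\<lambda>x. (U x, T x)) R) (u, t) / pmf (map_pmf T R) t"
proof -
  have ne: "set_pmf R \<inter> T -` {t} \<noteq> {}" using assms by auto
  have "pmf (map_pmf U (cond_pmf R (T -` {t}))) u = measure R (U -` {u} \<inter> T -` {t}) / measure R (T -` {t})"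
    unfolding pmf_map using measure_measure_pmf_not_zero[of R "T -` {t}"] ne
    by (simp add: cond_pmf.rep_eq[OF ne] measure_uniform_measure measure_pmf.emeasure_eq_measure Int_commute)
  also have "U -` {u} \<inter> T -` {t} = (\<lambda>x. (U x, T x)) -` {(u, t)}" by auto
  finally show ?thesis by (simp add: pmf_map)
qed

lemma pmf_map_pos: "x \<in> set_pmf R \<Longrightarrow> 0 < pmf (map_pmf U R) (U x)"
  by (simp add: pmf_positive_iff)

section \<open>The equality case of Gibbs' inequality\<close>

text \<open>By \<open>ln r \<le> r - 1\<close>, every term \<open>q - p + p * ln (p / q)\<close> on
  the support is nonnegative. When the divergence is zero these terms sum to the
  \<open>q\<close>-mass of the support minus 1, which is at most 0, so each vanishes. Taking
  \<open>q\<close> to be a function on \<open>G\<close> instead of a pmf lets it be given by a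
  formula such as p(u,w) p(v,w) / p(w).\<close>

lemma gibbs_equality:
  assumes fin: "finite G" and sub: "set_pmf p \<subseteq> G"
    and nonneg: "\<And>x. x \<in> G \<Longrightarrow> 0 \<le> q x" and pos: "\<And>x. x \<in> set_pmf p \<Longrightarrow> 0 < q x"
    and sum: "sum q G = 1"
    and zero: "measure_pmf.expectation p (\<lambda>x. log 2 (pmf p x / q x)) = 0"
    and "x \<in> G"
  shows "pmf p x = q x"
proof -
  let ?S = "set_pmf p"
  have finS: "finite ?S" using fin sub finite_subset by blast
  have p1: "sum (pmf p) ?S = 1" using finS by (intro sum_pmf_eq_1) auto
  have "(\<Sum>x\<in>?S. pmf p x * log 2 (pmf p x / q x)) = 0"
    using zero integral_measure_pmf_real[OF finS, of p "\<lambda>x. log 2 (pmf p x / q x)"]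
    by (simp add: mult.commute)
  then have ln0: "(\<Sum>x\<in>?S. pmf p x * ln (pmf p x / q x)) = 0"
    by (simp add: log_def flip: sum_divide_distrib)
  have term_nonneg: "0 \<le> q y - pmf p y + pmf p y * ln (pmf p y / q y)"
    and term_zero: "q y - pmf p y + pmf p y * ln (pmf p y / q y) = 0 \<Longrightarrow> q y = pmf p y"
    if "y \<in> ?S" for y
  proof -
    have pp: "0 < pmf p y" and qp: "0 < q y" using that pos pmf_positive by auto
    \<comment> \<open>With r = q / p the term is p (r - 1 - ln r), which is zero only at r =
      1.\<close>
    have e: "q y - pmf p y + pmf p y * ln (pmf p y / q y) = pmf p y * (q y / pmf p y - 1 - ln (q y / pmf p y))"
      using pp qp by (simp add: ln_div field_simps)
    show "0 \<le> q y - pmf p y + pmf p y * ln (pmf p y / q y)"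
      unfolding e using pp qp ln_le_minus_one[of "q y / pmf p y"] by simp
    assume "q y - pmf p y + pmf p y * ln (pmf p y / q y) = 0"
    then have "ln (q y / pmf p y) = q y / pmf p y - 1" using pp e by simp
    then show "q y = pmf p y" using ln_eq_minus_one[of "q y / pmf p y"] pp qp by simp
  qed
  have split: "sum q G = sum q ?S + sum q (G - ?S)"
    using sum.subset_diff[OF sub fin, of q] by simp
  have rest: "0 \<le> sum q (G - ?S)" using nonneg by (intro sum_nonneg) auto
  have tot: "(\<Sum>y\<in>?S. q y - pmf p y + pmf p y * ln (pmf p y / q y)) = sum q ?S - 1"
    by (simp add: sum.distrib sum_subtractf ln0 p1)
  moreover have "0 \<le> (\<Sum>y\<in>?S. q y - pmf p y + pmf p y * ln (pmf p y / q y))"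
    using term_nonneg by (intro sum_nonneg) auto
  \<comment> \<open>Nonnegativity of the terms makes the \<open>q\<close>-mass of the support at
    least 1, and the total mass 1 makes it at most 1; nothing is left for
    \<open>G - ?S\<close>.\<close>
  ultimately have S1: "sum q ?S = 1" and R0: "sum q (G - ?S) = 0" using split rest sum by auto
  show ?thesis
  proof (cases "x \<in> ?S")
    case True
    have "\<forall>y\<in>?S. q y - pmf p y + pmf p y * ln (pmf p y / q y) = 0"
      using tot S1 term_nonneg finS by (subst sum_nonneg_eq_0_iff[symmetric]) auto
    with term_zero True show ?thesis by simp
  next
    case False
    have "\<forall>y\<in>G - ?S. q y = 0"
      using R0 nonneg fin by (subst sum_nonneg_eq_0_iff[symmetric]) auto
    with False \<open>x \<in> G\<close> show ?thesis by (simp add: set_pmf_iff)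
  qed
qed

section \<open>Information quantities as expected log-ratios of point masses\<close>

text \<open>Both pmfs are densities with respect to counting measure, which is sigma-finite on a
  countable type. The inclusion of supports is absolute continuity of \<open>q\<close> with respect
  to \<open>p\<close>.\<close>

lemma KL_divergence_measure_pmf:
  fixes p q :: "'a::countable pmf"
  assumes "set_pmf q \<subseteq> set_pmf p"
  shows "KL_divergence 2 (measure_pmf p) (measure_pmf q) =
    measure_pmf.expectation q (\<lambda>x. log 2 (pmf q x / pmf p x))"
proof -
  interpret sigma_finite_measure "count_space (UNIV :: 'a set)"
    by (rule sigma_finite_measure_count_space)
  have "KL_divergence 2 (measure_pmf p) (measure_pmf q) =
      KL_divergence 2 (density (count_space UNIV) (pmf p)) (density (count_space UNIV) (pmf q))"
    by (simp add: measure_pmf_eq_density)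
  also have "\<dots> = (\<integral>x. pmf q x * log 2 (pmf q x / pmf p x) \<partial>count_space UNIV)"
    using assms by (intro KL_density_density) (auto simp: AE_count_space set_pmf_iff)
  also have "\<dots> = measure_pmf.expectation q (\<lambda>x. log 2 (pmf q x / pmf p x))"
    by (simp add: measure_pmf_eq_density[of q] integral_density)
  finally show ?thesis .
qed

text \<open>Countability makes the product of the two discrete sigma-algebras the full power set, so
  agreement on singletons suffices.\<close>

lemma measure_pmf_pair:
  fixes p :: "'a::countable pmf" and q :: "'b::countable pmf"
  shows "measure_pmf p \<Otimes>\<^sub>M measure_pmf q = measure_pmf (pair_pmf p q)"
proof (rule measure_eqI_countable[where A = UNIV])
  have "sets (measure_pmf p \<Otimes>\<^sub>M measure_pmf q) =
      sets (count_space (UNIV :: 'a set) \<Otimes>\<^sub>M count_space (UNIV :: 'b set))"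
    by (intro sets_pair_measure_cong) auto
  then show "sets (measure_pmf p \<Otimes>\<^sub>M measure_pmf q) = Pow UNIV"
    by (simp only: pair_measure_countable[OF countableI_type countableI_type] UNIV_Times_UNIV sets_count_space)
  fix a :: "'a \<times> 'b"
  obtain x y where a: "a = (x, y)" by (cases a)
  have "emeasure (measure_pmf p \<Otimes>\<^sub>M measure_pmf q) ({x} \<times> {y}) = emeasure p {x} * emeasure q {y}"
    by (intro measure_pmf.emeasure_pair_measure_Times) auto
  then show "emeasure (measure_pmf p \<Otimes>\<^sub>M measure_pmf q) {a} = emeasure (pair_pmf p q) {a}"
    by (simp add: a emeasure_pmf_single pmf_pair ennreal_mult)
qed auto

lemma mutual_information_measure_pmf:
  fixes U :: "'w \<Rightarrow> 'a::countable" and V :: "'w \<Rightarrow> 'b::countable"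
  shows "prob_space.mutual_information (measure_pmf R) 2 (count_space UNIV) (count_space UNIV) U V =
    measure_pmf.expectation R (\<lambda>x. log 2 (pmf (map_pmf (\<lambda>x. (U x, V x)) R) (U x, V x) /
      (pmf (map_pmf U R) (U x) * pmf (map_pmf V R) (V x))))"
proof -
  have "prob_space.mutual_information (measure_pmf R) 2 (count_space UNIV) (count_space UNIV) U V =
      KL_divergence 2 (measure_pmf (map_pmf U R) \<Otimes>\<^sub>M measure_pmf (map_pmf V R))
        (measure_pmf (map_pmf (\<lambda>x. (U x, V x)) R))"
    by (simp add: prob_space.mutual_information_def[OF prob_space_measure_pmf] pair_measure_countable map_pmf_rep_eq)
  \<comment> \<open>The support of a joint law lies in the product of the supports of its marginals,
    so absolute continuity is automatic.\<close>
  also have "\<dots> = measure_pmf.expectation (map_pmf (\<lambda>x. (U x, V x)) R)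
     (\<lambda>a. log 2 (pmf (map_pmf (\<lambda>x. (U x, V x)) R) a / pmf (pair_pmf (map_pmf U R) (map_pmf V R)) a))"
    unfolding measure_pmf_pair by (intro KL_divergence_measure_pmf) auto
  finally show ?thesis by (simp add: pmf_pair)
qed

lemma mutual_info_eq_expectation:
  fixes U :: "'w \<Rightarrow> 'a::countable" and V :: "'w \<Rightarrow> 'b::countable"
  shows "mutual_info R U V =
    measure_pmf.expectation R (\<lambda>x. log 2 (pmf (map_pmf (\<lambda>x. (U x, V x)) R) (U x, V x) /
      (pmf (map_pmf U R) (U x) * pmf (map_pmf V R) (V x))))"
  unfolding mutual_info_def by (rule mutual_information_measure_pmf)

text \<open>In the chain rule difference the marginal of \<open>U\<close> cancels; this is
  legitimate on the support, where all masses are positive. The denominator is left as p(u,w) p(v,w)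
  / p(w) because that is the comparison function for \<open>gibbs_equality\<close>.\<close>

lemma cond_mutual_info_eq_expectation:
  fixes U :: "'w \<Rightarrow> 'a::countable" and V :: "'w \<Rightarrow> 'b::countable" and W :: "'w \<Rightarrow> 'c::countable"
  assumes "finite (set_pmf R)"
  shows "cond_mutual_info R U V W =
    measure_pmf.expectation R (\<lambda>x. log 2
      (pmf (map_pmf (\<lambda>x. (U x, V x, W x)) R) (U x, V x, W x) /
       (pmf (map_pmf (\<lambda>x. (U x, W x)) R) (U x, W x) * pmf (map_pmf (\<lambda>x. (V x, W x)) R) (V x, W x)
         / pmf (map_pmf W R) (W x))))"
proof -
  have "cond_mutual_info R U V W = mutual_info R U (\<lambda>x. (V x, W x)) - mutual_info R U W"
    unfolding cond_mutual_info_def mutual_info_def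
      prob_space.conditional_mutual_information_def[OF prob_space_measure_pmf]
    by (simp add: pair_measure_countable)
  also have "\<dots> = measure_pmf.expectation R (\<lambda>x.
      log 2 (pmf (map_pmf (\<lambda>x. (U x, V x, W x)) R) (U x, V x, W x) /
        (pmf (map_pmf U R) (U x) * pmf (map_pmf (\<lambda>x. (V x, W x)) R) (V x, W x))) -
      log 2 (pmf (map_pmf (\<lambda>x. (U x, W x)) R) (U x, W x) /
        (pmf (map_pmf U R) (U x) * pmf (map_pmf W R) (W x))))"
    unfolding mutual_info_eq_expectation
    by (intro Bochner_Integration.integral_diff[symmetric] integrable_measure_pmf_finite assms)
  also have "\<dots> = measure_pmf.expectation R (\<lambda>x. log 2
      (pmf (map_pmf (\<lambda>x. (U x, V x, W x)) R) (U x, V x, W x) /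
       (pmf (map_pmf (\<lambda>x. (U x, W x)) R) (U x, W x) * pmf (map_pmf (\<lambda>x. (V x, W x)) R) (V x, W x)
         / pmf (map_pmf W R) (W x))))"
  proof (intro integral_cong_AE)
    show "AE x in measure_pmf R.
      log 2 (pmf (map_pmf (\<lambda>x. (U x, V x, W x)) R) (U x, V x, W x) /
        (pmf (map_pmf U R) (U x) * pmf (map_pmf (\<lambda>x. (V x, W x)) R) (V x, W x))) -
      log 2 (pmf (map_pmf (\<lambda>x. (U x, W x)) R) (U x, W x) /
        (pmf (map_pmf U R) (U x) * pmf (map_pmf W R) (W x))) =
      log 2 (pmf (map_pmf (\<lambda>x. (U x, V x, W x)) R) (U x, V x, W x) /
       (pmf (map_pmf (\<lambda>x. (U x, W x)) R) (U x, W x) * pmf (map_pmf (\<lambda>x. (V x, W x)) R) (V x, W x)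
         / pmf (map_pmf W R) (W x)))" (is "AE x in _. ?E x")
      unfolding AE_measure_pmf_iff
    proof
      fix x assume x: "x \<in> set_pmf R"
      note pmf_map_pos[OF x, of "\<lambda>x. (U x, V x, W x)"] pmf_map_pos[OF x, of "\<lambda>x. (V x, W x)"]
        pmf_map_pos[OF x, of "\<lambda>x. (U x, W x)"] pmf_map_pos[OF x, of U] pmf_map_pos[OF x, of W]
      then show "?E x"
        by (simp add: log_divide log_mult)
    qed
  qed auto
  finally show ?thesis .
qed

section \<open>Vanishing information as factorisation of point masses\<close>

text \<open>Forwards, Gibbs' equality case applies on the support of the product law, and outside it
  both masses are zero. Backwards, every log-ratio on the support is log 1.\<close>

lemma mutual_info_eq_0_iff:
  fixes U :: "'w \<Rightarrow> 'a::countable" and V :: "'w \<Rightarrow> 'b::countable"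
  assumes fin: "finite (set_pmf R)"
  shows "mutual_info R U V = 0 \<longleftrightarrow>
    map_pmf (\<lambda>x. (U x, V x)) R = pair_pmf (map_pmf U R) (map_pmf V R)"
proof
  let ?p = "map_pmf (\<lambda>x. (U x, V x)) R" and ?q = "pair_pmf (map_pmf U R) (map_pmf V R)"
  assume "mutual_info R U V = 0"
  then have z: "measure_pmf.expectation ?p (\<lambda>a. log 2 (pmf ?p a / pmf ?q a)) = 0"
    by (simp add: mutual_info_eq_expectation pmf_pair)
  have "pmf ?p a = pmf ?q a" for a
  proof (cases "a \<in> set_pmf ?q")
    case True
    show ?thesis
      by (rule gibbs_equality[OF _ _ _ _ _ z True]) (use fin in \<open>auto intro!: sum_pmf_eq_1 pmf_positive\<close>)
  next
    case False
    then have "a \<notin> set_pmf ?p" by auto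
    with False show ?thesis by (simp add: set_pmf_iff del: set_pair_pmf set_map_pmf)
  qed
  then show "?p = ?q" by (rule pmf_eqI)
next
  assume *: "map_pmf (\<lambda>x. (U x, V x)) R = pair_pmf (map_pmf U R) (map_pmf V R)"
  have "AE x in measure_pmf R. log 2 (pmf (map_pmf (\<lambda>x. (U x, V x)) R) (U x, V x) /
      (pmf (map_pmf U R) (U x) * pmf (map_pmf V R) (V x))) = 0"
    using pmf_map_pos[of _ R U] pmf_map_pos[of _ R V]
    by (auto simp: * AE_measure_pmf_iff pmf_pair less_le)
  then show "mutual_info R U V = 0"
    unfolding mutual_info_eq_expectation by (rule integral_eq_zero_AE)
qed

lemma cond_mutual_info_eq_0I:
  fixes U :: "'w \<Rightarrow> 'a::countable" and V :: "'w \<Rightarrow> 'b::countable" and W :: "'w \<Rightarrow> 'c::countable"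
  assumes "finite (set_pmf R)"
    and *: "\<And>x. x \<in> set_pmf R \<Longrightarrow>
      pmf (map_pmf (\<lambda>x. (U x, V x, W x)) R) (U x, V x, W x) * pmf (map_pmf W R) (W x) =
      pmf (map_pmf (\<lambda>x. (U x, W x)) R) (U x, W x) * pmf (map_pmf (\<lambda>x. (V x, W x)) R) (V x, W x)"
  shows "cond_mutual_info R U V W = 0"
  unfolding cond_mutual_info_eq_expectation[OF assms(1)]
proof (rule integral_eq_zero_AE, unfold AE_measure_pmf_iff, rule ballI)
  fix x assume x: "x \<in> set_pmf R"
  note pmf_map_pos[OF x, of "\<lambda>x. (U x, V x, W x)"] pmf_map_pos[OF x, of W]
  then show "log 2
      (pmf (map_pmf (\<lambda>x. (U x, V x, W x)) R) (U x, V x, W x) /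
       (pmf (map_pmf (\<lambda>x. (U x, W x)) R) (U x, W x) * pmf (map_pmf (\<lambda>x. (V x, W x)) R) (V x, W x)
         / pmf (map_pmf W R) (W x))) = 0"
    by (simp flip: *[OF x])
qed

text \<open>Gibbs' equality case is applied with \<open>?q\<close>, the law that keeps the (U,W) and
  (V,W) marginals and makes \<open>U\<close> and \<open>V\<close> independent given
  \<open>W\<close>.\<close>

lemma cond_mutual_info_eq_0D:
  fixes U :: "'w \<Rightarrow> 'a::countable" and V :: "'w \<Rightarrow> 'b::countable" and W :: "'w \<Rightarrow> 'c::countable"
  assumes fin: "finite (set_pmf R)" and zero: "cond_mutual_info R U V W = 0"
    and w: "w \<in> W ` set_pmf R"
  shows "pmf (map_pmf (\<lambda>x. (U x, V x, W x)) R) (u, v, w) =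
    pmf (map_pmf (\<lambda>x. (U x, W x)) R) (u, w) * pmf (map_pmf (\<lambda>x. (V x, W x)) R) (v, w)
      / pmf (map_pmf W R) w"
proof -
  let ?p = "map_pmf (\<lambda>x. (U x, V x, W x)) R"
  let ?q = "\<lambda>(u, v, w). pmf (map_pmf (\<lambda>x. (U x, W x)) R) (u, w) *
    pmf (map_pmf (\<lambda>x. (V x, W x)) R) (v, w) / pmf (map_pmf W R) w"
  let ?A = "U ` set_pmf R" and ?B = "V ` set_pmf R" and ?C = "W ` set_pmf R"
  show ?thesis
  proof (cases "u \<in> ?A \<and> v \<in> ?B")
    case True
    have margU: "(\<Sum>u\<in>?A. pmf (map_pmf (\<lambda>x. (U x, W x)) R) (u, w)) = pmf (map_pmf W R) w" for w
    proof -
      have "pmf (map_pmf (\<lambda>x. (U x, W x)) R) (u, w) = pmf (map_pmf (\<lambda>x. (W x, U x)) R) (w, u)" for u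
        by (auto simp: pmf_map intro!: arg_cong[where f = "measure (measure_pmf R)"])
      then show ?thesis using pmf_map_marginal[of ?A U R W w] fin by simp
    qed
    have margV: "(\<Sum>v\<in>?B. pmf (map_pmf (\<lambda>x. (V x, W x)) R) (v, w)) = pmf (map_pmf W R) w" for w
    proof -
      have "pmf (map_pmf (\<lambda>x. (V x, W x)) R) (v, w) = pmf (map_pmf (\<lambda>x. (W x, V x)) R) (w, v)" for v
        by (auto simp: pmf_map intro!: arg_cong[where f = "measure (measure_pmf R)"])
      then show ?thesis using pmf_map_marginal[of ?B V R W w] fin by simp
    qed
    \<comment> \<open>To see that \<open>?q\<close> has mass 1, the sum over w is moved outermost:
      the sums over u and v then each give p(w), leaving p(w) p(w) / p(w).\<close>
    have "sum ?q (?A \<times> ?B \<times> ?C) = (\<Sum>u\<in>?A. \<Sum>v\<in>?B. \<Sum>w\<in>?C. ?q (u, v, w))"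
      by (simp add: sum.cartesian_product)
    also have "\<dots> = (\<Sum>u\<in>?A. \<Sum>w\<in>?C. \<Sum>v\<in>?B. ?q (u, v, w))"
      by (intro sum.cong refl sum.swap)
    also have "\<dots> = (\<Sum>w\<in>?C. \<Sum>u\<in>?A. \<Sum>v\<in>?B. ?q (u, v, w))"
      by (rule sum.swap)
    also have "\<dots> = (\<Sum>w\<in>?C. pmf (map_pmf W R) w * pmf (map_pmf W R) w / pmf (map_pmf W R) w)"
      by (simp only: prod.case sum_divide_distrib[symmetric] sum_distrib_left[symmetric]
          sum_distrib_right[symmetric] margU margV)
    also have "\<dots> = (\<Sum>w\<in>?C. pmf (map_pmf W R) w)" by simp
    also have "\<dots> = 1" using fin by (intro sum_pmf_eq_1) auto
    finally have sum1: "sum ?q (?A \<times> ?B \<times> ?C) = 1" .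
    have "measure_pmf.expectation ?p (\<lambda>a. log 2 (pmf ?p a / ?q a)) = 0"
      using zero by (simp add: cond_mutual_info_eq_expectation[OF fin])
    moreover have "0 < ?q a" if "a \<in> set_pmf ?p" for a
    proof -
      from that obtain x where x: "x \<in> set_pmf R" and a: "a = (U x, V x, W x)" by auto
      show ?thesis
        unfolding a using pmf_map_pos[OF x, of "\<lambda>x. (U x, W x)"]
          pmf_map_pos[OF x, of "\<lambda>x. (V x, W x)"] pmf_map_pos[OF x, of W] by simp
    qed
    moreover have "set_pmf ?p \<subseteq> ?A \<times> ?B \<times> ?C" by auto
    ultimately have "pmf ?p (u, v, w) = ?q (u, v, w)"
      using True w fin by (intro gibbs_equality[OF _ _ _ _ sum1]) auto
    then show ?thesis by simp
  next
    case False
    \<comment> \<open>A value never attained on the support also annihilates one of the pair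
      marginals in \<open>?q\<close>.\<close>
    then have "pmf ?p (u, v, w) = 0" "?q (u, v, w) = 0"
      by (auto simp: pmf_eq_0_set_pmf)
    then show ?thesis by simp
  qed
qed

text \<open>Adjoining \<open>U\<close> to \<open>W\<close> changes events only by null sets, so the
  factorisation reduces to p(v,w) p(w) = p(w) p(v,w).\<close>

lemma cond_mutual_info_fun_eq_0:
  fixes U :: "'w \<Rightarrow> 'a::countable" and V :: "'w \<Rightarrow> 'b::countable" and W :: "'w \<Rightarrow> 'c::countable"
  assumes "finite (set_pmf R)" and U: "\<And>x. x \<in> set_pmf R \<Longrightarrow> U x = g (W x)"
  shows "cond_mutual_info R U V W = 0"
proof (rule cond_mutual_info_eq_0I[OF assms(1)])
  fix x assume "x \<in> set_pmf R"
  then have "pmf (map_pmf (\<lambda>x. (U x, V x, W x)) R) (U x, V x, W x) = pmf (map_pmf (\<lambda>x. (V x, W x)) R) (V x, W x)"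
    "pmf (map_pmf (\<lambda>x. (U x, W x)) R) (U x, W x) = pmf (map_pmf W R) (W x)"
    unfolding pmf_map using U
    by (auto simp: AE_measure_pmf_iff intro!: measure_pmf.finite_measure_eq_AE)
  then show "pmf (map_pmf (\<lambda>x. (U x, V x, W x)) R) (U x, V x, W x) * pmf (map_pmf W R) (W x) =
      pmf (map_pmf (\<lambda>x. (U x, W x)) R) (U x, W x) * pmf (map_pmf (\<lambda>x. (V x, W x)) R) (V x, W x)"
    by simp
qed

section \<open>Mixtures of product laws and the two implications\<close>

text \<open>Since the drawn index is recorded in the outcome, only component \<open>i\<close> of the
  mixture can produce \<open>(a, i)\<close>.\<close>

lemma pmf_bind_tagged:
  assumes "finite (set_pmf \<tau>)"
  shows "pmf (bind_pmf \<tau> (\<lambda>i. map_pmf (\<lambda>a. (a, i)) (Q i))) (a, i) = pmf \<tau> i * pmf (Q i) a"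
proof -
  have *: "pmf (map_pmf (\<lambda>a. (a, j)) (Q j)) (a, i) = (if j = i then pmf (Q i) a else 0)" for j
  proof (cases "j = i")
    case True
    then show ?thesis using pmf_map_inj'[of "\<lambda>a. (a, i)" "Q i" a] by (simp add: inj_on_def)
  qed (auto simp: pmf_eq_0_set_pmf)
  have "pmf (bind_pmf \<tau> (\<lambda>i. map_pmf (\<lambda>a. (a, i)) (Q i))) (a, i) =
      (\<Sum>j\<in>set_pmf \<tau>. (if j = i then pmf (Q i) a else 0) * pmf \<tau> j)"
    unfolding pmf_bind * using assms by (intro integral_measure_pmf_real) auto
  also have "\<dots> = (\<Sum>j\<in>set_pmf \<tau>. if j = i then pmf (Q i) a * pmf \<tau> i else 0)"
    by (intro sum.cong) auto
  also have "\<dots> = pmf \<tau> i * pmf (Q i) a" using assms by (auto simp: sum.delta set_pmf_iff)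
  finally show ?thesis .
qed

text \<open>Each information hypothesis supplies one half of membership in
  \<open>product_laws\<close> for the conditional laws \<open>Q t\<close>: \<open>XYT\<close> makes
  them products, and \<open>ZT\<close> fixes their image under \<open>f\<close>. The convex weights
  are the probabilities of T = t.\<close>

lemma convex_hull_product_laws_if_common_part:
  fixes P :: "('x::finite \<times> 'y::finite) pmf" and f :: "'x \<times> 'y \<Rightarrow> 'z::finite"
    and R :: "'w pmf" and T :: "'w \<Rightarrow> 't::countable"
  assumes fin: "finite (set_pmf R)"
    and law: "map_pmf (\<lambda>w. (X w, Y w, Z w)) R = map_pmf (\<lambda>(x, y). (x, y, f (x, y))) P"
    and ZT: "mutual_info R Z T = 0" and XYT: "cond_mutual_info R X Y T = 0"
  shows "pmf_vec P \<in> convex hull (pmf_vec ` product_laws f (map_pmf f P))"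
proof -
  define C where "C t = cond_pmf R (T -` {t})" for t
  define Q where "Q t = map_pmf (\<lambda>w. (X w, Y w)) (C t)" for t
  have P: "map_pmf (\<lambda>w. (X w, Y w)) R = P"
    using arg_cong[OF law, of "map_pmf (\<lambda>(x, y, z). (x, y))"]
    by (simp add: map_pmf_comp case_prod_unfold)
  have PZ: "map_pmf Z R = map_pmf f P"
    using arg_cong[OF law, of "map_pmf (\<lambda>(x, y, z). z)"]
    by (simp add: map_pmf_comp case_prod_unfold)
  \<comment> \<open>The equality of laws becomes pointwise on the support, because the right-hand
    law lives on the graph of \<open>f\<close>.\<close>
  have Z: "Z w = f (X w, Y w)" if "w \<in> set_pmf R" for w
  proof -
    have "(X w, Y w, Z w) \<in> set_pmf (map_pmf (\<lambda>(x, y). (x, y, f (x, y))) P)"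
      unfolding law[symmetric] using that by simp
    then show ?thesis by auto
  qed
  have Q: "Q t \<in> product_laws f (map_pmf f P)" if t: "t \<in> T ` set_pmf R" for t
  proof -
    have tpos: "pmf (map_pmf T R) t > 0" using t by (auto simp: pmf_map_pos)
    have setC: "set_pmf (C t) = set_pmf R \<inter> T -` {t}"
      unfolding C_def using t by (intro set_cond_pmf) auto
    have "Q t = pair_pmf (map_pmf X (C t)) (map_pmf Y (C t))"
    proof (rule pmf_eqI)
      fix a :: "'x \<times> 'y"
      obtain x y where a: "a = (x, y)" by (cases a)
      \<comment> \<open>Conditioning treats (X,Y) as a single variable, while the factorisation
        speaks of a triple; this regroups the tuple.\<close>
      have "pmf (map_pmf (\<lambda>w. ((X w, Y w), T w)) R) ((x, y), t) =
          pmf (map_pmf (\<lambda>w. (X w, Y w, T w)) R) (x, y, t)"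
        by (auto simp: pmf_map intro!: arg_cong[where f = "measure (measure_pmf R)"])
      then show "pmf (Q t) a = pmf (pair_pmf (map_pmf X (C t)) (map_pmf Y (C t))) a"
        using tpos unfolding a Q_def C_def pmf_pair pmf_map_cond_pmf[OF t]
        by (simp add: cond_mutual_info_eq_0D[OF fin XYT t])
    qed
    then have "mutual_info (Q t) fst snd = 0"
      by (subst mutual_info_eq_0_iff) (simp_all add: map_fst_pair_pmf map_snd_pair_pmf)
    moreover have "map_pmf f (Q t) = map_pmf f P"
    proof -
      have "map_pmf f (Q t) = map_pmf Z (C t)"
        unfolding Q_def map_pmf_comp using setC Z by (intro map_pmf_cong) auto
      \<comment> \<open>By independence of \<open>Z\<close> and \<open>T\<close>, the conditional
        mass of z given t is p(z) p(t) / p(t).\<close>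
      also have "\<dots> = map_pmf Z R"
        using tpos ZT unfolding C_def mutual_info_eq_0_iff[OF fin]
        by (intro pmf_eqI) (simp add: pmf_map_cond_pmf[OF t] pmf_pair)
      finally show ?thesis by (simp add: PZ)
    qed
    ultimately show ?thesis by (simp add: product_laws_def)
  qed
  have "pmf_vec P = (\<Sum>t\<in>T ` set_pmf R. pmf (map_pmf T R) t *\<^sub>R pmf_vec (Q t))"
  proof (rule vec_eq_iff[THEN iffD2], rule allI)
    fix a
    \<comment> \<open>The law of total probability over the finitely many values of
      \<open>T\<close>.\<close>
    have "pmf P a = (\<Sum>t\<in>T ` set_pmf R. pmf (map_pmf (\<lambda>w. ((X w, Y w), T w)) R) (a, t))"
      using pmf_map_marginal[of "T ` set_pmf R" T R "\<lambda>w. (X w, Y w)" a] fin by (simp add: P)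
    also have "\<dots> = (\<Sum>t\<in>T ` set_pmf R. pmf (map_pmf T R) t * pmf (Q t) a)"
      by (intro sum.cong refl)
        (auto simp: Q_def C_def pmf_map_cond_pmf pmf_eq_0_set_pmf)
    finally show "pmf_vec P $ a = (\<Sum>t\<in>T ` set_pmf R. pmf (map_pmf T R) t *\<^sub>R pmf_vec (Q t)) $ a"
      by (simp add: pmf_vec_def)
  qed
  also have "\<dots> \<in> convex hull (pmf_vec ` product_laws f (map_pmf f P))"
  proof (intro convex_sum convex_convex_hull)
    show "sum (pmf (map_pmf T R)) (T ` set_pmf R) = 1"
      using fin by (intro sum_pmf_eq_1) auto
  qed (use fin Q in \<open>auto intro: hull_inc\<close>)
  finally show ?thesis .
qed

lemma common_part_if_convex_hull_product_laws:
  fixes P :: "('x::finite \<times> 'y::finite) pmf" and f :: "'x \<times> 'y \<Rightarrow> 'z::finite"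
  defines "X \<equiv> \<lambda>(x, y, z, t). x" and "Y \<equiv> \<lambda>(x, y, z, t). y"
    and "Z \<equiv> \<lambda>(x, y, z, t). z" and "T \<equiv> \<lambda>(x, y, z, t). t"
  assumes "pmf_vec P \<in> convex hull (pmf_vec ` product_laws f (map_pmf f P))"
  obtains R :: "('x \<times> 'y \<times> 'z \<times> nat) pmf"
  where "map_pmf (\<lambda>w. (X w, Y w, Z w)) R = map_pmf (\<lambda>(x, y). (x, y, f (x, y))) P"
    and "finite (set_pmf (map_pmf T R))"
    and "cond_mutual_info R Z T (\<lambda>w. (X w, Y w)) = 0"
    and "mutual_info R Z T = 0"
    and "cond_mutual_info R X Y T = 0"
proof -
  \<comment> \<open>The indexed description of the hull uses natural number indices, which serve
    directly as the values of \<open>T\<close>.\<close>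
  obtain k :: nat and u v where
    uv: "\<forall>i\<in>{1..k}. 0 \<le> u i \<and> v i \<in> pmf_vec ` product_laws f (map_pmf f P)"
    and u1: "sum u {1..k} = 1" and vP: "(\<Sum>i = 1..k. u i *\<^sub>R v i) = pmf_vec P"
    using assms(5) unfolding convex_hull_indexed by blast
  from uv have "\<forall>i. \<exists>q. i \<in> {1..k} \<longrightarrow> q \<in> product_laws f (map_pmf f P) \<and> v i = pmf_vec q"
    by blast
  then obtain Q where Q: "\<And>i. i \<in> {1..k} \<Longrightarrow> Q i \<in> product_laws f (map_pmf f P)"
    and vQ: "\<And>i. i \<in> {1..k} \<Longrightarrow> v i = pmf_vec (Q i)" by metis
  \<comment> \<open>The law of \<open>T\<close>: the convex coefficients, extended by 0 to all
    natural numbers.\<close>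
  define \<tau> where "\<tau> = embed_pmf (\<lambda>i. if i \<in> {1..k} then u i else 0)"
  have pmf_\<tau>: "pmf \<tau> i = (if i \<in> {1..k} then u i else 0)" for i
    unfolding \<tau>_def
  proof (rule pmf_embed_pmf)
    have "(\<integral>\<^sup>+ i. ennreal (if i \<in> {1..k} then u i else 0) \<partial>count_space UNIV) =
        (\<Sum>i\<in>{1..k}. ennreal (if i \<in> {1..k} then u i else 0))"
      by (intro nn_integral_count_space') auto
    also have "\<dots> = ennreal (\<Sum>i\<in>{1..k}. u i)" using uv by (simp add: sum_ennreal del: atLeastAtMost_iff One_nat_def)
    finally show "(\<integral>\<^sup>+ i. ennreal (if i \<in> {1..k} then u i else 0) \<partial>count_space UNIV) = 1"
      using u1 by simp
  qed (use uv in auto)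
  have set_\<tau>: "set_pmf \<tau> \<subseteq> {1..k}" by (auto simp: set_pmf_iff pmf_\<tau> split: if_splits)
  have fin_\<tau>: "finite (set_pmf \<tau>)" using set_\<tau> by (rule finite_subset) simp
  \<comment> \<open>Outside \<open>{1..k}\<close> the choice \<open>Q i\<close> is unspecified, but
    such indices have mass zero under \<open>\<tau>\<close>.\<close>
  have Q_\<tau>: "Q i \<in> product_laws f (map_pmf f P)" if "i \<in> set_pmf \<tau>" for i
    using Q set_\<tau> that by blast
  \<comment> \<open>Sampling order: draw i from \<open>\<tau>\<close>, then (x,y) from
    \<open>Q i\<close>, and set z = f(x,y) and t = i.\<close>
  define R where "R = bind_pmf \<tau> (\<lambda>i. map_pmf (\<lambda>(x, y). (x, y, f (x, y), i)) (Q i))"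
  have mapR: "map_pmf h R = bind_pmf \<tau> (\<lambda>i. map_pmf (\<lambda>(x, y). h (x, y, f (x, y), i)) (Q i))"
    for h :: "_ \<Rightarrow> 'b"
    by (simp add: R_def map_bind_pmf map_pmf_comp case_prod_unfold)
  have fin: "finite (set_pmf R)" using fin_\<tau> by (auto simp: R_def)
  have P: "bind_pmf \<tau> Q = P"
  proof (rule pmf_eqI)
    fix a
    have "pmf (bind_pmf \<tau> Q) a = (\<Sum>i\<in>{1..k}. pmf (Q i) a * pmf \<tau> i)"
      unfolding pmf_bind using set_\<tau> by (intro integral_measure_pmf_real) auto
    also have "\<dots> = (\<Sum>i = 1..k. u i *\<^sub>R v i) $ a"
      by (simp add: pmf_\<tau> vQ pmf_vec_def mult.commute)
    also have "\<dots> = pmf P a" unfolding vP by (simp add: pmf_vec_def)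
    finally show "pmf (bind_pmf \<tau> Q) a = pmf P a" .
  qed
  have mapT: "map_pmf T R = \<tau>"
    by (simp add: mapR T_def case_prod_unfold map_pmf_const bind_return_pmf')
  have ZT: "map_pmf (\<lambda>w. (Z w, T w)) R = pair_pmf (map_pmf f P) \<tau>"
  proof -
    have "map_pmf (\<lambda>w. (Z w, T w)) R = bind_pmf \<tau> (\<lambda>i. map_pmf (\<lambda>z. (z, i)) (map_pmf f (Q i)))"
      by (simp add: mapR Z_def T_def case_prod_unfold map_pmf_comp)
    \<comment> \<open>All components have the same image under \<open>f\<close>, so the law of z no
      longer depends on i and the two draws are independent.\<close>
    also have "\<dots> = bind_pmf \<tau> (\<lambda>i. map_pmf (\<lambda>z. (z, i)) (map_pmf f P))"
      using Q_\<tau> by (intro bind_pmf_cong) (auto simp: product_laws_def)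
    also have "\<dots> = pair_pmf (map_pmf f P) \<tau>"
      unfolding pair_pmf_def map_pmf_def[of "\<lambda>z. (z, _)"] by (rule bind_commute_pmf)
    finally show ?thesis .
  qed
  show thesis
  proof
    have "map_pmf (\<lambda>w. (X w, Y w, Z w)) R = map_pmf (\<lambda>(x, y). (x, y, f (x, y))) (bind_pmf \<tau> Q)"
      by (simp add: mapR X_def Y_def Z_def map_bind_pmf)
    then show "map_pmf (\<lambda>w. (X w, Y w, Z w)) R = map_pmf (\<lambda>(x, y). (x, y, f (x, y))) P"
      by (simp add: P)
    show "finite (set_pmf (map_pmf T R))" using fin by simp
    show "cond_mutual_info R Z T (\<lambda>w. (X w, Y w)) = 0"
      by (rule cond_mutual_info_fun_eq_0[OF fin, where g = f])
        (auto simp: R_def X_def Y_def Z_def)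
    have "map_pmf Z R = map_pmf f P"
      using arg_cong[OF ZT, of "map_pmf fst"] by (simp add: map_pmf_comp map_fst_pair_pmf)
    with ZT mapT show "mutual_info R Z T = 0"
      by (simp add: mutual_info_eq_0_iff[OF fin])
    show "cond_mutual_info R X Y T = 0"
    proof (rule cond_mutual_info_eq_0I[OF fin])
      fix w assume "w \<in> set_pmf R"
      define x y t where xyt: "x = X w" "y = Y w" "t = T w"
      have t: "t \<in> set_pmf \<tau>" using \<open>w \<in> set_pmf R\<close> mapT[symmetric] by (simp add: xyt)
      \<comment> \<open>All three laws in the factorisation are mixtures tagged by \<open>T\<close>;
        both sides come out as the square of \<open>pmf \<tau> t\<close> times the two marginal
        masses of \<open>Q t\<close>.\<close>
      have XT: "pmf (map_pmf (\<lambda>w. (X w, T w)) R) (x, t) = pmf \<tau> t * pmf (map_pmf fst (Q t)) x"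
        using pmf_bind_tagged[OF fin_\<tau>, of "\<lambda>i. map_pmf fst (Q i)" x t]
        by (simp add: mapR X_def T_def case_prod_unfold map_pmf_comp)
      have YT: "pmf (map_pmf (\<lambda>w. (Y w, T w)) R) (y, t) = pmf \<tau> t * pmf (map_pmf snd (Q t)) y"
        using pmf_bind_tagged[OF fin_\<tau>, of "\<lambda>i. map_pmf snd (Q i)" y t]
        by (simp add: mapR Y_def T_def case_prod_unfold map_pmf_comp)
      have "pmf (map_pmf (\<lambda>w. (X w, Y w, T w)) R) (x, y, t) =
          pmf (map_pmf (\<lambda>w. ((X w, Y w), T w)) R) ((x, y), t)"
        by (auto simp: pmf_map intro!: arg_cong[where f = "measure (measure_pmf R)"])
      also have "\<dots> = pmf \<tau> t * pmf (Q t) (x, y)"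
        using pmf_bind_tagged[OF fin_\<tau>, of Q "(x, y)" t]
        by (simp add: mapR X_def Y_def T_def case_prod_unfold map_pmf_comp)
      also have "Q t = pair_pmf (map_pmf fst (Q t)) (map_pmf snd (Q t))"
        using Q_\<tau>[OF t] mutual_info_eq_0_iff[of "Q t" fst snd] by (simp add: product_laws_def)
      finally have "pmf (map_pmf (\<lambda>w. (X w, Y w, T w)) R) (x, y, t) =
          pmf \<tau> t * (pmf (map_pmf fst (Q t)) x * pmf (map_pmf snd (Q t)) y)"
        by (simp add: pmf_pair)
      with XT YT show "pmf (map_pmf (\<lambda>w. (X w, Y w, T w)) R) (X w, Y w, T w) * pmf (map_pmf T R) (T w) =
          pmf (map_pmf (\<lambda>w. (X w, T w)) R) (X w, T w) * pmf (map_pmf (\<lambda>w. (Y w, T w)) R) (Y w, T w)"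
        by (simp add: mapT flip: xyt)
    qed
  qed
qed

theorem lemma1:
  fixes P :: "('x::finite \<times> 'y::finite) pmf"
    and f :: "'x \<times> 'y \<Rightarrow> 'z::finite"
  shows "(\<exists>R :: ('x \<times> 'y \<times> 'z \<times> nat) pmf.
            let X = (\<lambda>(x, y, z, t). x); Y = (\<lambda>(x, y, z, t). y);
                Z = (\<lambda>(x, y, z, t). z); T = (\<lambda>(x, y, z, t). t)
            in map_pmf (\<lambda>w. (X w, Y w, Z w)) R = map_pmf (\<lambda>(x, y). (x, y, f (x, y))) P \<and>
               finite (set_pmf (map_pmf T R)) \<and>
               cond_mutual_info R Z T (\<lambda>w. (X w, Y w)) = 0 \<and>
               mutual_info R Z T = 0 \<and>
               cond_mutual_info R X Y T = 0)
         \<longleftrightarrow> pmf_vec P \<in> convex hull (pmf_vec ` product_laws f (map_pmf f P))"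
  (is "?lhs \<longleftrightarrow> ?rhs")
proof
  assume ?lhs
  then obtain R :: "('x \<times> 'y \<times> 'z \<times> nat) pmf" where
    law: "map_pmf (\<lambda>w. ((\<lambda>(x, y, z, t). x) w, (\<lambda>(x, y, z, t). y) w, (\<lambda>(x, y, z, t). z) w)) R =
      map_pmf (\<lambda>(x, y). (x, y, f (x, y))) P"
    and T: "finite (set_pmf (map_pmf (\<lambda>(x, y, z, t). t) R))"
    and I: "mutual_info R (\<lambda>(x, y, z, t). z) (\<lambda>(x, y, z, t). t) = 0"
      "cond_mutual_info R (\<lambda>(x, y, z, t). x) (\<lambda>(x, y, z, t). y) (\<lambda>(x, y, z, t). t) = 0"
    unfolding Let_def by blast
  \<comment> \<open>The other three alphabets are finite types, so finitely many values of
    \<open>T\<close> already force finite support of \<open>R\<close>.\<close>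
  have "set_pmf R \<subseteq> UNIV \<times> UNIV \<times> UNIV \<times> set_pmf (map_pmf (\<lambda>(x, y, z, t). t) R)"
    by force
  then have "finite (set_pmf R)"
    by (rule finite_subset) (use T in \<open>intro finite_cartesian_product finite\<close>)
  then show ?rhs by (rule convex_hull_product_laws_if_common_part[OF _ law I])
next
  assume ?rhs
  then show ?lhs
    unfolding Let_def by (rule common_part_if_convex_hull_product_laws) blast
qed

end
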